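(* Let $\mathbb{K}$ be a commutative superring. (i) Let $\varphi\in\mathbb{K}_0[[t]]$ be a solution of $$(\ast)\qquad -\frac{\varphi(t+u)-\varphi(t)}{u}\,\varphi(u)-\varphi(t)\,\frac{\varphi(t+u)-\varphi(u)}{t}=\varphi(t+u)\quad\text{in }\mathbb{K}_0[[t,u]].$$ If the constant term $c:=\varphi(0)$ is invertible, then $f(t):=\frac{\varphi(t)+t}{\varphi(t)}$ satisfies $$(\ast\ast)\qquad f(t)f(u)=f(t+u),\quad f(0)=1,\quad f'(0)=\frac1c .$$ (ii) For $c\in\mathbb{K}_0^\times$, the system $(\ast\ast)$ has a solution $f\in\mathbb{K}_0[[t]]$ if and only if $\mathbb{K}_0$ contains $\mathbb{Q}$. In this case the unique solution is $e^{t/c}\in\mathbb{K}_0[[t]]$. (iii) Let $\mathbb{K}\supseteq\mathbb{Q}$ and $c\in\mathbb{K}_0^\times$. The unique solution of $(\ast)$ in $\mathbb{K}_0[[t]]$ with $\varphi(0)=c$ is $$\varphi_c(t)=\frac{t}{e^{t/c}-1}.$$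
   Context: A commutative superring $\mathbb{K}=\mathbb{K}_0\oplus\mathbb{K}_1$ is a unital $\mathbb{Z}/2$-graded ring with $ab=(-1)^{p(a)p(b)}ba$ for homogeneous $a,b$ of parities $p(a),p(b)$, and $a^2=0$ for $a\in\mathbb{K}_1$. Thus $\mathbb{K}_0$ is an ordinary commutative ring; $\mathbb{K}_0^\times$ is its group of invertible elements. "Contains $\mathbb{Q}$" means that every positive integer is invertible in the ring. $t,u$ are commuting (even) variables. *)

theory Defs
  imports "HOL-Computational_Algebra.Formal_Power_Series"
begin

unbundle fps_syntax

text \<open>
  Unital rings are taken of sort \<open>{ring, monoid_mult}\<close> rather than \<open>ring_1\<close>, so that the zero
  ring is not excluded. The library makes power series a multiplicative monoid only over
  \<open>semiring_1\<close>; the instance below removes the assumption \<open>0 \<noteq> 1\<close>. As \<open>of_nat\<close> and \<open>fps_deriv\<close>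
  also need \<open>semiring_1\<close>, they are replaced by \<open>nmult\<close> and \<open>series_deriv\<close>.
\<close>

instance fps :: ("{semiring_0, monoid_mult}") monoid_mult
proof
  fix a :: "'a fps"
  show "1 * a = a"
    by (simp add: fps_eq_iff fps_mult_nth if_distrib [of "\<lambda>x. x * _"] sum.delta cong: if_cong)
  show "a * 1 = a"
  proof (rule fps_ext)
    fix n
    have "(a * 1) $ n = (\<Sum>i=0..n. if i = n then a $ i else 0)"
      unfolding fps_mult_nth by (intro sum.cong) auto
    then show "(a * 1) $ n = a $ n"
      by simp
  qed
qed

definition nmult :: "nat \<Rightarrow> 'a::comm_monoid_add \<Rightarrow> 'a" where
  "nmult n x = (\<Sum>i<n. x)"

text \<open>
  The whole type is the superring, \<open>K0\<close> is its even and \<open>K1\<close> its odd part. That \<open>1\<close> is even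
  follows from the axioms; see \<open>one_even\<close> below.
\<close>

locale comm_superring =
  fixes K0 K1 :: "'a::{ring, monoid_mult} set"
  assumes zero_even: "0 \<in> K0"
    and diff_even: "a \<in> K0 \<Longrightarrow> b \<in> K0 \<Longrightarrow> a - b \<in> K0"
    and zero_odd: "0 \<in> K1"
    and diff_odd: "a \<in> K1 \<Longrightarrow> b \<in> K1 \<Longrightarrow> a - b \<in> K1"
    and direct_sum: "\<exists>!p. p \<in> K0 \<times> K1 \<and> x = fst p + snd p"
    and even_even: "a \<in> K0 \<Longrightarrow> b \<in> K0 \<Longrightarrow> a * b \<in> K0"
    and even_odd: "a \<in> K0 \<Longrightarrow> b \<in> K1 \<Longrightarrow> a * b \<in> K1"
    and odd_even: "a \<in> K1 \<Longrightarrow> b \<in> K0 \<Longrightarrow> a * b \<in> K1"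
    and odd_odd: "a \<in> K1 \<Longrightarrow> b \<in> K1 \<Longrightarrow> a * b \<in> K0"
    and comm_even_even: "a \<in> K0 \<Longrightarrow> b \<in> K0 \<Longrightarrow> a * b = b * a"
    and comm_even_odd: "a \<in> K0 \<Longrightarrow> b \<in> K1 \<Longrightarrow> a * b = b * a"
    and anticomm_odd_odd: "a \<in> K1 \<Longrightarrow> b \<in> K1 \<Longrightarrow> a * b = - (b * a)"
    and odd_square: "a \<in> K1 \<Longrightarrow> a * a = 0"

definition invertibles :: "'a::monoid_mult set \<Rightarrow> 'a set" where
  "invertibles R = {x \<in> R. \<exists>y\<in>R. x * y = 1 \<and> y * x = 1}"

definition contains_rats :: "'a::{ring, monoid_mult} set \<Rightarrow> bool" where
  "contains_rats R \<longleftrightarrow> (\<forall>n>0. nmult n 1 \<in> invertibles R)"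

text \<open>
  The fraction \<open>a / b\<close> in \<open>R\<close>: the element \<open>q\<close> of \<open>R\<close> with \<open>q b = a\<close>, meaningful when there is
  exactly one. The denominator need not be invertible, as in \<open>t / (exp (t / c) - 1)\<close>.
\<close>

definition quot :: "'a::times set \<Rightarrow> 'a \<Rightarrow> 'a \<Rightarrow> 'a" where
  "quot R a b = (THE q. q \<in> R \<and> q * b = a)"

definition fps_over :: "'a set \<Rightarrow> 'a fps set" where
  "fps_over R = {f. \<forall>n. f $ n \<in> R}"

text \<open>
  Series in \<open>t, u\<close> are iterated series: \<open>F $ i $ j\<close> is the coefficient of \<open>t\<^sup>i u\<^sup>j\<close>, so the
  series in \<open>t, u\<close> over \<open>R\<close> form the set \<open>fps_over (fps_over R)\<close>.
\<close>

definition var_t :: "'a::{ring, monoid_mult} fps fps" where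
  "var_t = fps_X"

definition var_u :: "'a::{ring, monoid_mult} fps fps" where
  "var_u = fps_const fps_X"

text \<open>
  \<open>subst2 \<phi> w\<close> is \<open>\<phi>(w)\<close>, for \<open>w\<close> without constant term: \<open>w\<^sup>n\<close> then has no terms of total
  degree below \<open>n\<close>, so the coefficient of \<open>t\<^sup>i u\<^sup>j\<close> in \<open>\<Sum>n. \<phi>\<^sub>n w\<^sup>n\<close> is the finite sum below.
\<close>

definition subst2 :: "'a::{ring, monoid_mult} fps \<Rightarrow> 'a fps fps \<Rightarrow> 'a fps fps" where
  "subst2 \<phi> w = Abs_fps (\<lambda>i. Abs_fps (\<lambda>j. \<Sum>n\<le>i + j. \<phi> $ n * (w ^ n) $ i $ j))"

definition series_deriv :: "'a::comm_monoid_add fps \<Rightarrow> 'a fps" where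
  "series_deriv f = Abs_fps (\<lambda>n. nmult (n + 1) (f $ (n + 1)))"

definition exp_series :: "'a::{ring, monoid_mult} set \<Rightarrow> 'a \<Rightarrow> 'a fps" where
  "exp_series R a = Abs_fps (\<lambda>n. quot R (a ^ n) (nmult (fact n) 1))"

definition solves_functional_eq :: "'a::{ring, monoid_mult} set \<Rightarrow> 'a fps \<Rightarrow> bool" where
  "solves_functional_eq R \<phi> \<longleftrightarrow>
     - quot (fps_over (fps_over R)) (subst2 \<phi> (var_t + var_u) - subst2 \<phi> var_t) var_u
         * subst2 \<phi> var_u
     - subst2 \<phi> var_t
         * quot (fps_over (fps_over R)) (subst2 \<phi> (var_t + var_u) - subst2 \<phi> var_u) var_t
     = subst2 \<phi> (var_t + var_u)"

definition solves_exp_system :: "'a::{ring, monoid_mult} set \<Rightarrow> 'a \<Rightarrow> 'a fps \<Rightarrow> bool" where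
  "solves_exp_system R c f \<longleftrightarrow>
     subst2 f var_t * subst2 f var_u = subst2 f (var_t + var_u) \<and>
     f $ 0 = 1 \<and> series_deriv f $ 0 = quot R 1 c"


lemma (in comm_superring) one_even: "1 \<in> K0"
proof -
  obtain p where p: "p \<in> K0 \<times> K1" "1 = fst p + snd p"
    using direct_sum [of 1] by blast
  define e o1 where "e = fst p" and "o1 = snd p"
  have e: "e \<in> K0" and o1: "o1 \<in> K1" and one: "1 = e + o1"
    using p by (auto simp: e_def o1_def)
  have "e = e * e + e * o1"
    by (metis one distrib_left mult_1_right)
  moreover have "e * e \<in> K0" "e * o1 \<in> K1"
    using e o1 even_even even_odd by auto
  ultimately have "(e, 0) = (e * e, e * o1)"
    using direct_sum [of e] e zero_odd
    by (metis (no_types, lifting) SigmaI add.right_neutral fst_conv snd_conv)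
  moreover have "o1 = e * o1 + o1 * o1"
    by (metis one distrib_right mult_1_left)
  ultimately have "o1 = 0"
    using odd_square [OF o1] by simp
  then show ?thesis
    using e one by simp
qed

text \<open>The encoding of the variables and of substitution has the expected coefficients.\<close>

lemma nmult_0 [simp]: "nmult 0 x = 0"
  by (simp add: nmult_def)

lemma nmult_add: "nmult (m + n) x = nmult m x + nmult n x"
  by (induction n) (simp_all add: nmult_def ac_simps)

lemma nmult_1 [simp]: "nmult (Suc 0) x = x"
  by (simp add: nmult_def)

lemma mult_nmult_one: "(x::'a::{ring, monoid_mult}) * nmult n 1 = nmult n x"
  by (simp add: nmult_def sum_distrib_left)

lemma var_t_mult_nth: "(var_t * F) $ i $ j = (if i = 0 then 0 else F $ (i - 1) $ j)"
  by (simp add: var_t_def)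

lemma mult_var_t_nth: "(F * var_t) $ i $ j = (if i = 0 then 0 else F $ (i - 1) $ j)"
  by (simp add: var_t_def)

lemma var_u_mult_nth: "(var_u * F) $ i $ j = (if j = 0 then 0 else F $ i $ (j - 1))"
  by (simp add: var_u_def)

lemma mult_var_u_nth: "(F * var_u) $ i $ j = (if j = 0 then 0 else F $ i $ (j - 1))"
  by (simp add: var_u_def)

lemma var_t_power_nth: "(var_t ^ n) $ i $ j = (if i = n \<and> j = 0 then 1 else 0)"
proof (induction n arbitrary: i)
  case (Suc n)
  then show ?case by (cases i) (simp_all add: var_t_mult_nth del: fps_mult_nth_0)
qed simp

lemma var_u_power_nth: "(var_u ^ n) $ i $ j = (if i = 0 \<and> j = n then 1 else 0)"
proof (induction n arbitrary: j)
  case (Suc n)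
  then show ?case by (cases j) (simp_all add: var_u_mult_nth del: fps_mult_nth_0)
qed simp

lemma var_t_plus_u_power_nth:
  "((var_t + var_u) ^ n) $ i $ j = (if i + j = n then nmult (n choose i) 1 else 0)"
proof (induction n arbitrary: i j)
  case (Suc n)
  have rec: "((var_t + var_u) ^ Suc n) $ i $ j =
    (if i = 0 then 0 else ((var_t + var_u) ^ n) $ (i - 1) $ j) +
    (if j = 0 then 0 else ((var_t + var_u) ^ n) $ i $ (j - 1))"
    by (simp only: power_Suc distrib_right fps_add_nth var_t_mult_nth var_u_mult_nth)
  show ?case
    unfolding rec Suc.IH by (cases i; cases j) (auto simp: nmult_add binomial_eq_0)
qed simp

lemma subst2_var_t_nth: "subst2 \<phi> var_t $ i $ j = (if j = 0 then \<phi> $ i else 0)"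
  by (simp add: subst2_def var_t_power_nth if_distrib [of "\<lambda>x. _ * x"] cong: if_cong)

lemma subst2_var_u_nth: "subst2 \<phi> var_u $ i $ j = (if i = 0 then \<phi> $ j else 0)"
  by (simp add: subst2_def var_u_power_nth if_distrib [of "\<lambda>x. _ * x"] cong: if_cong)

lemma subst2_var_t_plus_u_nth:
  "subst2 \<phi> (var_t + var_u) $ i $ j = nmult ((i + j) choose i) (\<phi> $ (i + j))"
  by (simp add: subst2_def var_t_plus_u_power_nth if_distrib [of "\<lambda>x. _ * x"] mult_nmult_one
      cong: if_cong)

text \<open>Both fractions in \<open>solves_functional_eq\<close> are meaningful.\<close>

lemma (in comm_superring) nmult_even: "x \<in> K0 \<Longrightarrow> nmult n x \<in> K0"
proof (induction n)
  case (Suc n)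
  then have "nmult n x - (0 - x) \<in> K0"
    using diff_even zero_even by blast
  then show ?case
    by (simp add: nmult_def add.commute)
qed (simp add: zero_even)

lemma (in comm_superring) quotient_by_u:
  assumes "\<phi> \<in> fps_over K0"
  shows "\<exists>!q. q \<in> fps_over (fps_over K0) \<and>
    q * var_u = subst2 \<phi> (var_t + var_u) - subst2 \<phi> var_t"
proof (rule ex1I conjI)+
  let ?q = "Abs_fps (\<lambda>i. Abs_fps (\<lambda>j. subst2 \<phi> (var_t + var_u) $ i $ Suc j))"
  show "?q \<in> fps_over (fps_over K0)"
    using assms by (simp add: fps_over_def subst2_var_t_plus_u_nth nmult_even)
  show "?q * var_u = subst2 \<phi> (var_t + var_u) - subst2 \<phi> var_t"
    by (auto simp: fps_eq_iff mult_var_u_nth subst2_var_t_plus_u_nth subst2_var_t_nth)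
  fix q
  assume "q \<in> fps_over (fps_over K0) \<and>
    q * var_u = subst2 \<phi> (var_t + var_u) - subst2 \<phi> var_t"
  then have "(q * var_u) $ i $ Suc j = (subst2 \<phi> (var_t + var_u) - subst2 \<phi> var_t) $ i $ Suc j"
    for i j by simp
  then show "q = ?q"
    by (simp add: fps_eq_iff mult_var_u_nth subst2_var_t_nth)
qed

lemma (in comm_superring) quotient_by_t:
  assumes "\<phi> \<in> fps_over K0"
  shows "\<exists>!q. q \<in> fps_over (fps_over K0) \<and>
    q * var_t = subst2 \<phi> (var_t + var_u) - subst2 \<phi> var_u"
proof (rule ex1I conjI)+
  let ?q = "Abs_fps (\<lambda>i. subst2 \<phi> (var_t + var_u) $ Suc i)"
  show "?q \<in> fps_over (fps_over K0)"
    using assms by (simp add: fps_over_def subst2_var_t_plus_u_nth nmult_even)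
  show "?q * var_t = subst2 \<phi> (var_t + var_u) - subst2 \<phi> var_u"
    by (auto simp: fps_eq_iff mult_var_t_nth subst2_var_t_plus_u_nth subst2_var_u_nth)
  fix q
  assume "q \<in> fps_over (fps_over K0) \<and>
    q * var_t = subst2 \<phi> (var_t + var_u) - subst2 \<phi> var_u"
  then have "(q * var_t) $ Suc i $ j = (subst2 \<phi> (var_t + var_u) - subst2 \<phi> var_u) $ Suc i $ j"
    for i j by simp
  then show "q = ?q"
    by (simp add: fps_eq_iff mult_var_t_nth subst2_var_u_nth)
qed

end

theory Submission
  imports Defs
begin

text \<open>
  Put \<open>A = \<phi>(t)\<close>, \<open>B = \<phi>(u)\<close>, \<open>C = \<phi>(t + u)\<close>. Multiplying the functional equation by \<open>t u\<close>, which
  is not a zero divisor, turns it into \<open>A B (t + u) = C B t + A C u + C t u\<close>. If \<open>\<phi>\<close> is invertible,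
  dividing by \<open>A B C\<close> gives \<open>(1 + t / A) (1 + u / B) = 1 + (t + u) / C\<close>, that is, \<open>f = 1 + t / \<phi>\<close>
  is multiplicative. In coefficients, multiplicativity reads \<open>f\<^sub>i f\<^sub>j = ((i + j) choose i) f\<^sub>i\<^sub>+\<^sub>j\<close>, so
  \<open>n! f\<^sub>n = (f\<^sub>1)\<^sup>n\<close>; an invertible \<open>f\<^sub>1\<close> therefore forces every \<open>n!\<close> to be invertible, and then
  \<open>f\<close> is the exponential series. The ambient ring is noncommutative, so commutation of the even
  elements is tracked explicitly.
\<close>

section \<open>Natural multiples; products and inverses of series over a noncommutative ring\<close>

lemma nmult_zero [simp]: "nmult n 0 = 0"
  by (simp add: nmult_def)

lemma mult_nmult: "(x::'a::semiring_0) * nmult n y = nmult n (x * y)"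
  by (simp add: nmult_def sum_distrib_left)

lemma nmult_mult: "nmult n (x::'a::semiring_0) * y = nmult n (x * y)"
  by (simp add: nmult_def sum_distrib_right)

lemma nmult_nmult: "nmult m (nmult n x) = nmult (m * n) x"
  by (induction m) (simp_all add: nmult_def nmult_add [unfolded nmult_def] add.commute)

lemma nmult_sum_left: "nmult (\<Sum>i\<in>A. f i) x = (\<Sum>i\<in>A. nmult (f i) x)"
  by (induction A rule: infinite_finite_induct) (simp_all add: nmult_add)

lemma nmult_sum_right: "nmult n (\<Sum>i\<in>A. f i) = (\<Sum>i\<in>A. nmult n (f i))"
  unfolding nmult_def by (rule sum.swap)

text \<open>Commutation of the coefficients suffices. It is applied first to series with
  coefficients in \<open>K0\<close>, then to series whose coefficients are such series.\<close>

lemma fps_mult_commute: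
  fixes f g :: "'a::semiring_0 fps"
  assumes "\<And>i j. f $ i * g $ j = g $ j * f $ i"
  shows "f * g = g * f"
proof (rule fps_ext)
  fix n
  have "(f * g) $ n = (\<Sum>i=0..n. g $ (n - i) * f $ i)"
    by (simp add: fps_mult_nth assms)
  also have "\<dots> = (\<Sum>i=0..n. g $ i * f $ (n - i))"
    by (subst sum.atLeastAtMost_rev) simp
  finally show "(f * g) $ n = (g * f) $ n"
    by (simp add: fps_mult_nth)
qed

lemma fps_left_inverse_mult:
  fixes f :: "'a::{ring, monoid_mult} fps"
  assumes "x * f $ 0 = 1"
  shows "fps_left_inverse f x * f = 1"
proof (rule fps_ext)
  fix n
  show "(fps_left_inverse f x * f) $ n = 1 $ n"
  proof (cases n)
    case (Suc m)
    \<comment> \<open>By recursion the coefficient at \<open>Suc m\<close> is minus this sum times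
      \<open>x\<close>. Multiplied by \<open>f $ 0\<close> it becomes minus the sum and cancels the
      rest of the convolution.\<close>
    have "(\<Sum>i=0..m. fps_left_inverse_constructor f x i * f $ (Suc m - i)) * (x * f $ 0)
        = (\<Sum>i=0..m. fps_left_inverse_constructor f x i * f $ (Suc m - i))"
      by (simp only: assms mult_1_right)
    then show ?thesis
      by (simp add: Suc fps_mult_nth mult.assoc)
  qed (simp add: assms)
qed

section \<open>Compatibility of substitution with products and sums\<close>

lemma subst2_mult_var_t: "subst2 (f * g) var_t = subst2 f var_t * subst2 g var_t"
proof (intro fps_ext)
  fix i j
  have "(subst2 f var_t $ a * subst2 g var_t $ b) $ j = (if j = 0 then f $ a * g $ b else 0)"
    for a b
    by (cases j) (simp_all add: fps_mult_nth subst2_var_t_nth)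
  then show "subst2 (f * g) var_t $ i $ j = (subst2 f var_t * subst2 g var_t) $ i $ j"
    by (simp add: fps_mult_nth [of "subst2 f var_t"] fps_sum_nth subst2_var_t_nth fps_mult_nth [of f])
qed

lemma subst2_mult_var_u: "subst2 (f * g) var_u = subst2 f var_u * subst2 g var_u"
proof -
  \<comment> \<open>In the iterated encoding a series in \<open>u\<close> alone is constant with
    respect to the outer variable.\<close>
  have const: "subst2 h var_u = fps_const h" for h :: "'a fps"
    by (simp add: fps_eq_iff subst2_var_u_nth)
  show ?thesis
    by (simp add: const)
qed

text \<open>Vandermonde's identity: \<open>(i + j) choose i\<close> is the sum over \<open>a\<close>
  of \<open>(k choose a) * ((i + j - k) choose (i - a))\<close>, which distributes each
  \<open>f $ k * g $ (i + j - k)\<close> over the ways to share the exponent \<open>i\<close> of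
  \<open>t\<close> between the two factors.\<close>

lemma subst2_mult_var_t_plus_u:
  "subst2 (f * g) (var_t + var_u) = subst2 f (var_t + var_u) * subst2 g (var_t + var_u)"
proof (intro fps_ext)
  fix i j
  \<comment> \<open>Here \<open>k\<close> is the total degree taken from the first factor and
    \<open>a\<close> its exponent of \<open>t\<close>.\<close>
  let ?h = "\<lambda>a k. nmult ((k choose a) * ((i + j - k) choose (i - a))) (f $ k * g $ (i + j - k))"
  have inner: "(\<Sum>k\<le>i + j. ?h a k) = (subst2 f (var_t + var_u) $ a * subst2 g (var_t + var_u) $ (i - a)) $ j"
    if "a \<le> i" for a
  proof -
    \<comment> \<open>For \<open>k < a\<close> the first binomial vanishes, for
      \<open>k > a + j\<close> the second; then \<open>k = a + b\<close>, with \<open>b\<close> the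
      exponent of \<open>u\<close>.\<close>
    have "(\<Sum>k\<le>i + j. ?h a k) = (\<Sum>k\<in>{a..a + j}. ?h a k)"
      using that by (intro sum.mono_neutral_right) (auto simp: binomial_eq_0)
    also have "\<dots> = (\<Sum>b=0..j. ?h a (a + b))"
      using sum.shift_bounds_cl_nat_ivl [of "?h a" 0 a j] by (simp add: add.commute)
    also have "\<dots> = (\<Sum>b=0..j. nmult ((a + b) choose a) (f $ (a + b)) *
        nmult ((i - a + (j - b)) choose (i - a)) (g $ (i - a + (j - b))))"
      using that by (intro sum.cong) (auto simp: nmult_mult mult_nmult nmult_nmult mult.commute)
    finally show ?thesis
      by (simp add: fps_mult_nth subst2_var_t_plus_u_nth)
  qed
  have "subst2 (f * g) (var_t + var_u) $ i $ j
      = (\<Sum>k\<le>i + j. nmult ((i + j) choose i) (f $ k * g $ (i + j - k)))"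
    by (simp add: subst2_var_t_plus_u_nth fps_mult_nth nmult_sum_right atLeast0AtMost)
  also have "\<dots> = (\<Sum>k\<le>i + j. \<Sum>a\<le>i. ?h a k)"
  proof (rule sum.cong)
    fix k
    assume "k \<in> {..i + j}"
    then show "nmult ((i + j) choose i) (f $ k * g $ (i + j - k)) = (\<Sum>a\<le>i. ?h a k)"
      using vandermonde [of k "i + j - k" i] by (simp flip: nmult_sum_left)
  qed simp
  also have "\<dots> = (\<Sum>a\<le>i. \<Sum>k\<le>i + j. ?h a k)"
    by (rule sum.swap)
  also have "\<dots> = (\<Sum>a\<le>i. (subst2 f (var_t + var_u) $ a * subst2 g (var_t + var_u) $ (i - a)) $ j)"
    by (intro sum.cong) (simp_all add: inner)
  finally show "subst2 (f * g) (var_t + var_u) $ i $ j =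
      (subst2 f (var_t + var_u) * subst2 g (var_t + var_u)) $ i $ j"
    by (simp add: fps_mult_nth [of "subst2 f (var_t + var_u)"] fps_sum_nth atLeast0AtMost)
qed

lemma subst2_1: "subst2 1 var_t = 1" "subst2 1 var_u = 1" "subst2 1 (var_t + var_u) = 1"
  by (auto simp: fps_eq_iff subst2_var_t_nth subst2_var_u_nth subst2_var_t_plus_u_nth)

lemma subst2_add: "subst2 (f + g) w = subst2 f w + subst2 g w"
  by (simp add: fps_eq_iff subst2_def distrib_right sum.distrib)

lemma subst2_fps_X:
  "subst2 fps_X var_t = var_t" "subst2 fps_X var_u = var_u"
  "subst2 fps_X (var_t + var_u) = var_t + var_u"
proof -
  have nth: "var_t $ i $ j = (if i = 1 \<and> j = 0 then 1 else 0)"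
    "var_u $ i $ j = (if i = 0 \<and> j = 1 then 1 else 0)" for i j
    by (auto simp: var_t_def var_u_def)
  show "subst2 fps_X var_t = var_t" "subst2 fps_X var_u = var_u"
    by (auto simp: fps_eq_iff subst2_var_t_nth subst2_var_u_nth nth)
  show "subst2 fps_X (var_t + var_u) = var_t + var_u"
    by (auto simp: fps_eq_iff subst2_var_t_plus_u_nth nth add_is_1)
qed

section \<open>Central variables and the passage to reciprocals\<close>

lemma var_t_commute: "var_t * F = F * var_t"
  by (simp add: var_t_def fps_mult_fps_X_commute)

lemma var_u_commute: "var_u * F = F * var_u"
  by (intro fps_ext) (simp add: var_u_mult_nth mult_var_u_nth)

text \<open>Multiplying by both variables shifts both indices by one, so no coefficient is
  lost.\<close>

lemma mult_var_t_var_u_eq_iff: "F * var_t * var_u = G * var_t * var_u \<longleftrightarrow> F = G"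
proof
  assume eq: "F * var_t * var_u = G * var_t * var_u"
  have "(H * var_t * var_u) $ Suc i $ Suc j = H $ i $ j" for H :: "'a fps fps" and i j
    by (simp add: mult_var_u_nth mult_var_t_nth)
  then show "F = G"
    by (metis eq fps_ext)
qed simp

text \<open>The two sides of the first equation are \<open>A * B * C\<close> times
  \<open>(s + w) * C'\<close> and times \<open>(1 + s * A') * (1 + w * B') - 1\<close>; the left
  inverse \<open>C' * B' * A'\<close> removes the common factor.\<close>

lemma addition_formula_iff:
  fixes A B C A' B' C' s w :: "'a::{ring, monoid_mult}"
  assumes inv: "A * A' = 1" "B * B' = 1" "C * C' = 1" "A' * A = 1" "B' * B = 1" "C' * C = 1"
    and comm: "A * B = B * A" "A * C = C * A" "B * C = C * B"
    and central: "\<And>x. x * s = s * x" "\<And>x. x * w = w * x"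
  shows "A * B * (s + w) = C * B * s + A * C * w + C * s * w \<longleftrightarrow>
    (1 + s * A') * (1 + w * B') = 1 + (s + w) * C'"
proof -
  have left: "x * (y * z) = y * (x * z)" if "x * y = y * x" for x y z :: 'a
    by (metis that mult.assoc)
  have cancel: "x * (y * z) = z" if "x * y = 1" for x y z :: 'a
    by (metis that mult.assoc mult_1_left)
  have inverse_commute: "x * z = z * x" if "x * y = y * x" "y * z = 1" "z * y = 1" for x y z :: 'a
    by (metis that mult.assoc mult_1_left mult_1_right)
  have comm': "A * B' = B' * A" "A * C' = C' * A" "B * C' = C' * B"
    using comm inv inverse_commute by blast+
  \<comment> \<open>Each commutation is oriented so that \<open>s\<close> and \<open>w\<close> move
    to the front and every element comes to stand next to its own inverse, where it cancels.\<close>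
  note rules = central(1)[of A] central(1)[of B] central(1)[of C] central(1)[of A'] central(1) [of B']
    central(1)[of C'] central(1)[of w] central(2)[of A] central(2)[of B] central(2)[of C]
    central(2)[of A'] central(2)[of B'] central(2)[of C'] comm comm'
  note simps = rules rules [THEN left] inv(1-3) inv(1-3) [THEN cancel]
  have lhs: "A * B * (s + w) = A * B * C * ((s + w) * C')"
    by (simp add: distrib_left distrib_right mult.assoc simps)
  have rhs: "C * B * s + A * C * w + C * s * w = A * B * C * ((1 + s * A') * (1 + w * B') - 1)"
    by (simp add: distrib_left distrib_right mult.assoc simps add.assoc)
  have "C' * B' * A' * (A * B * C) = 1"
    using inv by (metis mult.assoc mult_1_left)
  then have cancel_left: "A * B * C * x = A * B * C * y \<longleftrightarrow> x = y" for x y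
    by (metis mult.assoc mult_1_left)
  show ?thesis
    unfolding lhs rhs cancel_left by (auto simp: eq_diff_eq add.commute)
qed

section \<open>Even elements and series with even coefficients\<close>

context comm_superring
begin

lemma invertible_inverse:
  assumes "c \<in> invertibles K0"
  shows "quot K0 1 c \<in> K0" "quot K0 1 c * c = 1" "c * quot K0 1 c = 1"
proof -
  obtain d where d: "d \<in> K0" "c * d = 1" "d * c = 1"
    using assms by (auto simp: invertibles_def)
  have "quot K0 1 c = d"
    unfolding quot_def
    by (rule the_equality) (use d in \<open>auto, metis mult.assoc mult_1_left mult_1_right\<close>)
  then show "quot K0 1 c \<in> K0" "quot K0 1 c * c = 1" "c * quot K0 1 c = 1"
    using d by auto
qed

lemma minus_even: "a \<in> K0 \<Longrightarrow> - a \<in> K0"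
  using diff_even [OF zero_even] by simp

lemma add_even: "a \<in> K0 \<Longrightarrow> b \<in> K0 \<Longrightarrow> a + b \<in> K0"
  using diff_even [OF _ minus_even] by simp

lemma sum_even: "(\<And>i. i \<in> A \<Longrightarrow> f i \<in> K0) \<Longrightarrow> sum f A \<in> K0"
  by (induction A rule: infinite_finite_induct) (simp_all add: zero_even add_even)

lemma power_even: "a \<in> K0 \<Longrightarrow> a ^ n \<in> K0"
  by (induction n) (simp_all add: one_even even_even)

lemma fps_over_mult_commute:
  "f \<in> fps_over K0 \<Longrightarrow> g \<in> fps_over K0 \<Longrightarrow> f * g = g * f"
  by (rule fps_mult_commute) (simp add: fps_over_def comm_even_even)

lemma fps_over_mult_commute2:
  "F \<in> fps_over (fps_over K0) \<Longrightarrow> G \<in> fps_over (fps_over K0) \<Longrightarrow> F * G = G * F"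
  by (rule fps_mult_commute) (simp add: fps_over_def [of "fps_over K0"] fps_over_mult_commute)

lemma subst2_in_fps_over:
  assumes "\<phi> \<in> fps_over K0"
  shows "subst2 \<phi> var_t \<in> fps_over (fps_over K0)" "subst2 \<phi> var_u \<in> fps_over (fps_over K0)"
    "subst2 \<phi> (var_t + var_u) \<in> fps_over (fps_over K0)"
  using assms
  by (simp_all add: fps_over_def subst2_var_t_nth subst2_var_u_nth subst2_var_t_plus_u_nth
      nmult_even zero_even)

text \<open>The recursion for a left inverse stays in \<open>K0\<close>, and commutation of even
  series makes that inverse two-sided.\<close>

lemma fps_over_inverse:
  assumes "f \<in> fps_over K0" "f $ 0 \<in> invertibles K0"
  obtains g where "g \<in> fps_over K0" "f * g = 1" "g * f = 1"
proof -
  obtain x where x: "x \<in> K0" "x * f $ 0 = 1"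
    using invertible_inverse [OF assms(2)] by blast
  have "fps_left_inverse_constructor f x n \<in> K0" for n
  proof (induction n rule: less_induct)
    case (less n)
    have "f $ k \<in> K0" for k
      using assms(1) by (simp add: fps_over_def)
    with less x(1) show ?case
      by (cases n) (auto intro!: even_even minus_even sum_even)
  qed
  then have "fps_left_inverse f x \<in> fps_over K0"
    by (simp add: fps_over_def)
  with assms(1) x(2) fps_left_inverse_mult that show ?thesis
    by (metis fps_over_mult_commute)
qed

section \<open>The functional equation as multiplicativity\<close>

lemma solves_functional_eq_iff:
  assumes "\<phi> \<in> fps_over K0"
  shows "solves_functional_eq K0 \<phi> \<longleftrightarrow>
    subst2 \<phi> var_t * subst2 \<phi> var_u * (var_t + var_u) =
      subst2 \<phi> (var_t + var_u) * subst2 \<phi> var_u * var_t +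
      subst2 \<phi> var_t * subst2 \<phi> (var_t + var_u) * var_u +
      subst2 \<phi> (var_t + var_u) * var_t * var_u"
    (is "_ \<longleftrightarrow> ?A * ?B * (_ + _) = ?C * ?B * _ + ?A * ?C * _ + ?C * _ * _")
proof -
  define Q R where "Q = quot (fps_over (fps_over K0)) (?C - ?A) var_u"
    and "R = quot (fps_over (fps_over K0)) (?C - ?B) var_t"
  have Q: "Q * var_u = ?C - ?A"
    using theI' [OF quotient_by_u [OF assms]] by (simp add: Q_def quot_def)
  have R: "R * var_t = ?C - ?B"
    using theI' [OF quotient_by_t [OF assms]] by (simp add: R_def quot_def)
  have "Q * ?B * var_t * var_u = (Q * var_u) * ?B * var_t"
    by (simp only: mult.assoc var_u_commute [of "?B * var_t"])
  moreover have "?A * R * var_t * var_u = ?A * (R * var_t) * var_u"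
    by (simp add: mult.assoc)
  \<comment> \<open>Substituting \<open>?C - ?A\<close> for \<open>Q * var_u\<close> and
    \<open>?C - ?B\<close> for \<open>R * var_t\<close> leaves \<open>?A * ?B\<close> once with
    \<open>var_t\<close> and once with \<open>var_u\<close>.\<close>
  ultimately have eq: "(- Q * ?B - ?A * R) * var_t * var_u =
      ?A * ?B * (var_t + var_u) - (?C * ?B * var_t + ?A * ?C * var_u)"
    unfolding left_diff_distrib minus_mult_left [symmetric] Q R
    by (simp add: left_diff_distrib right_diff_distrib distrib_left)
  have "solves_functional_eq K0 \<phi> \<longleftrightarrow>
      (- Q * ?B - ?A * R) * var_t * var_u = ?C * var_t * var_u"
    unfolding mult_var_t_var_u_eq_iff by (simp add: solves_functional_eq_def Q_def R_def)
  then show ?thesis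
    unfolding eq diff_eq_eq by (simp only: add.commute)
qed

text \<open>As substitution respects products, the values of \<open>\<psi>\<close> at
  \<open>t\<close>, \<open>u\<close> and \<open>t + u\<close> invert those of \<open>\<phi>\<close>,
  so \<open>addition_formula_iff\<close> applies.\<close>

lemma solves_functional_eq_iff_multiplicative:
  assumes "\<phi> \<in> fps_over K0" "\<psi> \<in> fps_over K0" "\<phi> * \<psi> = 1"
  defines "f \<equiv> 1 + fps_X * \<psi>"
  shows "solves_functional_eq K0 \<phi> \<longleftrightarrow>
    subst2 f var_t * subst2 f var_u = subst2 f (var_t + var_u)"
proof -
  have "\<psi> * \<phi> = 1"
    using assms fps_over_mult_commute by metis
  note inverses = assms(3) this
  note mult = subst2_mult_var_t subst2_mult_var_u subst2_mult_var_t_plus_u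
  note inv = inverses [THEN arg_cong, of "\<lambda>f. subst2 f var_t", unfolded subst2_1 mult]
    inverses [THEN arg_cong, of "\<lambda>f. subst2 f var_u", unfolded subst2_1 mult]
    inverses [THEN arg_cong, of "\<lambda>f. subst2 f (var_t + var_u)", unfolded subst2_1 mult]
  note over = subst2_in_fps_over [OF assms(1)]
  show ?thesis
    unfolding solves_functional_eq_iff [OF assms(1)] f_def subst2_add mult subst2_fps_X subst2_1
    by (rule addition_formula_iff inv over var_t_commute [symmetric] var_u_commute [symmetric]
        fps_over_mult_commute2)+
qed

section \<open>The exponential system and invertibility of the positive integers\<close>

lemma multiplicative_iff:
  "subst2 f var_t * subst2 f var_u = subst2 f (var_t + var_u) \<longleftrightarrow>
    (\<forall>i j. f $ i * f $ j = nmult ((i + j) choose i) (f $ (i + j)))"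
proof -
  \<comment> \<open>With \<open>f(u)\<close> constant in \<open>t\<close> and each coefficient of
    \<open>f(t)\<close> constant in \<open>u\<close>, the product has \<open>f $ i * f $ j\<close>
    at \<open>t^i u^j\<close>.\<close>
  have "subst2 f var_u = fps_const f"
    by (simp add: fps_eq_iff subst2_var_u_nth)
  moreover have "subst2 f var_t $ i = fps_const (f $ i)" for i
    by (simp add: fps_eq_iff subst2_var_t_nth)
  ultimately show ?thesis
    by (simp add: fps_eq_iff [of "_ * _"] fps_eq_iff [of "_ * f"] subst2_var_t_plus_u_nth)
qed

text \<open>Multiplicativity at \<open>i = 1\<close> is a recursion free of division, so this serves
  both to derive \<open>contains_rats K0\<close> and, given it, to prove uniqueness.\<close>

lemma solves_exp_system_imp_nmult_fact:
  assumes "solves_exp_system K0 c f"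
  shows "nmult (fact n) (f $ n) = quot K0 1 c ^ n"
proof (induction n)
  case 0
  then show ?case
    using assms by (simp add: solves_exp_system_def)
next
  case (Suc n)
  have "f $ 1 = quot K0 1 c"
    using assms by (simp add: solves_exp_system_def series_deriv_def)
  moreover have "f $ 1 * f $ n = nmult (Suc n) (f $ Suc n)"
    using assms by (auto simp: solves_exp_system_def multiplicative_iff)
  moreover have "nmult (fact (Suc n)) (f $ Suc n) = nmult (fact n) (nmult (Suc n) (f $ Suc n))"
    by (simp only: nmult_nmult fact_Suc of_nat_id mult.commute)
  ultimately show ?case
    by (simp only: mult_nmult power_Suc flip: Suc.IH)
qed

lemma contains_rats_inverse:
  assumes "contains_rats K0" "n > 0"
  obtains r where "r \<in> K0" "nmult n 1 * r = 1" "r * nmult n 1 = 1"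
proof -
  have "nmult n 1 \<in> invertibles K0"
    using assms by (simp add: contains_rats_def)
  note inv = invertible_inverse [OF this]
  show ?thesis
    by (rule that [OF inv(1,3,2)])
qed

lemma nmult_cancel:
  fixes x y :: 'a
  assumes "contains_rats K0" "n > 0" "nmult n x = nmult n y"
  shows "x = y"
proof -
  obtain r where r: "r \<in> K0" "nmult n 1 * r = 1" "r * nmult n 1 = 1"
    using contains_rats_inverse [OF assms(1,2)] .
  have "x * nmult n 1 * r = y * nmult n 1 * r"
    using assms(3) by (simp add: mult_nmult_one)
  then show ?thesis
    by (simp only: mult.assoc r mult_1_right)
qed

text \<open>Invertibility of \<open>n!\<close> makes the quotient in \<open>exp_series\<close> well
  defined; afterwards the series is handled through \<open>n! e_n = d^n\<close>.\<close>

lemma exp_series_nth: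
  assumes "contains_rats K0" "d \<in> K0"
  shows "exp_series K0 d $ n \<in> K0" "nmult (fact n) (exp_series K0 d $ n) = d ^ n"
proof -
  let ?N = "nmult (fact n) 1 :: 'a"
  obtain r where r: "r \<in> K0" "?N * r = 1" "r * ?N = 1"
    using contains_rats_inverse [OF assms(1) fact_gt_zero] .
  have "\<exists>!q. q \<in> K0 \<and> q * ?N = d ^ n"
  proof (rule ex1I)
    show "d ^ n * r \<in> K0 \<and> d ^ n * r * ?N = d ^ n"
      using r by (simp only: mult.assoc even_even power_even assms(2) mult_1_right simp_thms)
  next
    fix q
    assume "q \<in> K0 \<and> q * ?N = d ^ n"
    then have "d ^ n * r = q * ?N * r"
      by simp
    then show "q = d ^ n * r"
      by (simp only: mult.assoc r mult_1_right)
  qed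
  from theI' [OF this]
  show "exp_series K0 d $ n \<in> K0" "nmult (fact n) (exp_series K0 d $ n) = d ^ n"
    by (simp_all add: exp_series_def quot_def mult_nmult_one)
qed

text \<open>Multiplied by \<open>i! j!\<close>, both sides become \<open>d^(i + j)\<close>, because
  \<open>(i + j)!\<close> is \<open>i! j!\<close> times the binomial coefficient; then
  \<open>i! j!\<close> cancels.\<close>

lemma exp_series_multiplicative:
  assumes "contains_rats K0" "d \<in> K0"
  defines "e \<equiv> exp_series K0 d"
  shows "subst2 e var_t * subst2 e var_u = subst2 e (var_t + var_u)"
  unfolding multiplicative_iff
proof (intro allI)
  fix i j
  note e = exp_series_nth(2) [OF assms(1,2), folded e_def]
  have "nmult (fact i * fact j) (e $ i * e $ j) = nmult (fact i) (e $ i) * nmult (fact j) (e $ j)"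
    by (simp add: nmult_mult mult_nmult nmult_nmult mult.commute)
  also have "\<dots> = nmult (fact (i + j)) (e $ (i + j))"
    by (simp add: e power_add)
  also have "fact (i + j) = fact i * fact j * ((i + j) choose i)"
    using binomial_fact_lemma [of i "i + j"] by simp
  finally show "e $ i * e $ j = nmult ((i + j) choose i) (e $ (i + j))"
    using nmult_cancel [OF assms(1), of "fact i * fact j"] by (simp flip: nmult_nmult)
qed

lemma exp_series_nth_0_1:
  assumes "contains_rats K0" "d \<in> K0"
  shows "exp_series K0 d $ 0 = 1" "exp_series K0 d $ Suc 0 = d"
  using exp_series_nth(2) [OF assms, of 0] exp_series_nth(2) [OF assms, of 1] by simp_all

text \<open>Uniqueness: both series have \<open>n\<close>-th coefficient \<open>x\<close> with
  \<open>n! x = d^n\<close>, and \<open>n!\<close> cancels.\<close>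

lemma solves_exp_system_iff:
  assumes "contains_rats K0" "c \<in> invertibles K0"
  shows "f \<in> fps_over K0 \<and> solves_exp_system K0 c f \<longleftrightarrow> f = exp_series K0 (quot K0 1 c)"
proof -
  define d where "d = quot K0 1 c"
  note d = assms(1) invertible_inverse(1) [OF assms(2), folded d_def]
  show ?thesis
    unfolding d_def [symmetric]
  proof
    assume "f \<in> fps_over K0 \<and> solves_exp_system K0 c f"
    then have "nmult (fact n) (f $ n) = nmult (fact n) (exp_series K0 d $ n)" for n
      by (simp only: solves_exp_system_imp_nmult_fact [of c f] exp_series_nth(2) [OF d] flip: d_def)
    then show "f = exp_series K0 d"
      using nmult_cancel [OF assms(1) fact_gt_zero] fps_ext by blast
  next
    assume "f = exp_series K0 d"
    then show "f \<in> fps_over K0 \<and> solves_exp_system K0 c f"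
      using exp_series_nth(1) [OF d] exp_series_nth_0_1 [OF d] exp_series_multiplicative [OF d]
      by (simp add: fps_over_def solves_exp_system_def series_deriv_def d_def)
  qed
qed

lemma solves_exp_system_imp_contains_rats:
  assumes "c \<in> invertibles K0" "f \<in> fps_over K0" "solves_exp_system K0 c f"
  shows "contains_rats K0"
  unfolding contains_rats_def
proof (intro allI impI)
  fix n :: nat
  assume "n > 0"
  then have fact: "fact n = n * fact (n - 1)"
    by (simp add: fact_reduce)
  define d where "d = quot K0 1 c"
  note c = invertible_inverse [OF assms(1), folded d_def]
  \<comment> \<open>From \<open>n! f_n = d^n\<close> and \<open>n! = n (n - 1)!\<close>,
    multiplication by \<open>c^n\<close> exhibits this \<open>r\<close> as the inverse of
    \<open>n\<close>.\<close>
  define r where "r = nmult (fact (n - 1)) (f $ n) * c ^ n"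
  have "f $ n \<in> K0" "c \<in> K0"
    using assms by (auto simp: fps_over_def invertibles_def)
  then have r: "r \<in> K0"
    by (simp add: r_def even_even nmult_even power_even)
  have "d ^ n * c ^ n = 1"
  proof (induction n)
    case (Suc n)
    have "d ^ Suc n * c ^ Suc n = d * (d ^ n * c ^ n) * c"
      by (simp only: power_Suc [of d] power_Suc2 [of c] mult.assoc)
    then show ?case
      by (simp add: Suc c)
  qed simp
  moreover have "nmult n 1 * r = nmult (fact n) (f $ n) * c ^ n"
    by (simp add: r_def nmult_mult nmult_nmult fact)
  ultimately have "nmult n 1 * r = 1"
    using solves_exp_system_imp_nmult_fact [OF assms(3), of n] by (simp add: d_def)
  moreover have "r * nmult n 1 = nmult n 1 * r"
    by (simp add: mult_nmult nmult_mult)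
  ultimately show "nmult n 1 \<in> invertibles K0"
    using r by (auto simp: invertibles_def nmult_even one_even)
qed

text \<open>If \<open>y\<close> inverts \<open>n\<close>, splitting \<open>y\<close> into even and
  odd parts splits \<open>1 = n y\<close> as well, since \<open>n\<close> is even. Comparison with
  \<open>1 = 1 + 0\<close> shows that the even part of \<open>y\<close> already inverts
  \<open>n\<close>.\<close>

lemma contains_rats_even:
  assumes "contains_rats (UNIV :: 'a set)"
  shows "contains_rats K0"
  unfolding contains_rats_def
proof (intro allI impI)
  fix n :: nat
  assume "n > 0"
  then obtain y :: 'a where y: "nmult n 1 * y = 1"
    using assms unfolding contains_rats_def invertibles_def by blast
  obtain p where p: "fst p \<in> K0" "snd p \<in> K1" "y = fst p + snd p"
    using direct_sum [of y] by (metis mem_Times_iff)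
  have N: "nmult n 1 \<in> K0"
    by (simp add: nmult_even one_even)
  have "(1, 0) = (nmult n 1 * fst p, nmult n 1 * snd p)"
  proof (rule ex1E [OF direct_sum [of 1]])
    fix q
    assume unique: "\<forall>q'. q' \<in> K0 \<times> K1 \<and> 1 = fst q' + snd q' \<longrightarrow> q' = q"
    have "(1, 0) = q" "(nmult n 1 * fst p, nmult n 1 * snd p) = q"
      using y p N by (auto intro!: unique [rule_format] simp: one_even zero_odd even_even even_odd
          simp flip: distrib_left)
    then show ?thesis
      by simp
  qed
  then have "nmult n 1 * fst p = 1"
    by simp
  then show "nmult n 1 \<in> invertibles K0"
    using p N comm_even_even by (auto simp: invertibles_def)
qed

section \<open>Solutions of the functional equation\<close>

lemma quot_add_fps_X:
  assumes "\<phi> \<in> fps_over K0" "\<psi> \<in> fps_over K0" "\<phi> * \<psi> = 1"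
  shows "quot (fps_over K0) (\<phi> + fps_X) \<phi> = 1 + fps_X * \<psi>"
  unfolding quot_def
proof (rule the_equality)
  have "\<psi> * \<phi> = 1"
    using assms fps_over_mult_commute by metis
  then show "1 + fps_X * \<psi> \<in> fps_over K0 \<and> (1 + fps_X * \<psi>) * \<phi> = \<phi> + fps_X"
    using assms by (auto simp: fps_over_def distrib_right mult.assoc zero_even one_even add_even)
next
  fix q
  assume "q \<in> fps_over K0 \<and> q * \<phi> = \<phi> + fps_X"
  then have "q * \<phi> * \<psi> = (\<phi> + fps_X) * \<psi>"
    by simp
  then show "q = 1 + fps_X * \<psi>"
    by (simp add: distrib_right mult.assoc assms(3))
qed

lemma functional_eq_imp_exp_system:
  assumes "\<phi> \<in> fps_over K0" "\<psi> \<in> fps_over K0" "\<phi> * \<psi> = 1" "solves_functional_eq K0 \<phi>"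
  shows "1 + fps_X * \<psi> \<in> fps_over K0" "solves_exp_system K0 (\<phi> $ 0) (1 + fps_X * \<psi>)"
proof -
  show "1 + fps_X * \<psi> \<in> fps_over K0"
    using assms(2) by (auto simp: fps_over_def one_even zero_even add_even)
  have even: "\<phi> $ 0 \<in> K0" "\<psi> $ 0 \<in> K0"
    using assms by (auto simp: fps_over_def)
  \<comment> \<open>The linear coefficient of \<open>1 + fps_X * \<psi>\<close> is
    \<open>\<psi> $ 0\<close>, so the derivative condition asks that it invert
    \<open>\<phi> $ 0\<close>.\<close>
  have \<psi>0: "\<phi> $ 0 * \<psi> $ 0 = 1"
    using arg_cong [OF assms(3), of "\<lambda>f. f $ 0"] by simp
  then have "\<phi> $ 0 \<in> invertibles K0"
    using even comm_even_even [OF even] unfolding invertibles_def by auto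
  note inv = invertible_inverse [OF this]
  have "quot K0 1 (\<phi> $ 0) * \<phi> $ 0 * \<psi> $ 0 = quot K0 1 (\<phi> $ 0)"
    by (simp only: mult.assoc \<psi>0 mult_1_right)
  then have "\<psi> $ 0 = quot K0 1 (\<phi> $ 0)"
    by (simp only: inv(2) mult_1_left)
  moreover have "subst2 (1 + fps_X * \<psi>) var_t * subst2 (1 + fps_X * \<psi>) var_u =
      subst2 (1 + fps_X * \<psi>) (var_t + var_u)"
    using solves_functional_eq_iff_multiplicative [OF assms(1-3)] assms(4) by blast
  ultimately show "solves_exp_system K0 (\<phi> $ 0) (1 + fps_X * \<psi>)"
    by (simp add: solves_exp_system_def series_deriv_def)
qed

text \<open>Since \<open>e - 1\<close> is \<open>fps_X\<close> times a series with constant term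
  \<open>1/c\<close>, the fraction is the inverse of that series, and multiplicativity of
  \<open>e\<close> makes it a solution.\<close>

lemma functional_eq_solution:
  assumes "contains_rats K0" "c \<in> invertibles K0"
  defines "e \<equiv> exp_series K0 (quot K0 1 c)"
  shows "\<exists>!q. q \<in> fps_over K0 \<and> q * (e - 1) = fps_X"
    and "\<phi> \<in> fps_over K0 \<and> solves_functional_eq K0 \<phi> \<and> \<phi> $ 0 = c \<longleftrightarrow>
      \<phi> = quot (fps_over K0) fps_X (e - 1)"
proof -
  define d where "d = quot K0 1 c"
  note d = invertible_inverse [OF assms(2), folded d_def]
  note e = exp_series_nth(1) [OF assms(1) d(1)] exp_series_nth_0_1 [OF assms(1) d(1)]
    exp_series_multiplicative [OF assms(1) d(1)]
  have c: "c \<in> K0"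
    using assms(2) by (simp add: invertibles_def)
  define \<psi> where "\<psi> = fps_shift 1 e"
  have e_eq: "e = 1 + fps_X * \<psi>"
    by (auto simp: fps_eq_iff \<psi>_def e_def e d_def[symmetric])
  have \<psi>: "\<psi> \<in> fps_over K0" "\<psi> $ 0 = d"
    using e by (simp_all add: \<psi>_def e_def d_def fps_over_def)
  then have "\<psi> $ 0 \<in> invertibles K0"
    using d c by (auto simp: invertibles_def)
  then obtain \<phi>0 where \<phi>0: "\<phi>0 \<in> fps_over K0" "\<psi> * \<phi>0 = 1" "\<phi>0 * \<psi> = 1"
    using fps_over_inverse \<psi>(1) by blast
  have X: "q * (e - 1) = q * \<psi> * fps_X" for q
    by (simp add: e_eq mult.assoc fps_mult_fps_X_commute)
  have cancel: "F = 1" if "F * fps_X = fps_X" for F :: "'a fps"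
  proof (rule fps_ext)
    fix n
    show "F $ n = 1 $ n"
      using arg_cong [OF that, of "\<lambda>g. g $ Suc n"] by simp
  qed
  \<comment> \<open>Cancelling \<open>fps_X\<close> leaves \<open>q * \<psi> = 1\<close>, which
    determines \<open>q\<close>.\<close>
  have sol: "q \<in> fps_over K0 \<and> q * (e - 1) = fps_X \<longleftrightarrow> q = \<phi>0" for q
  proof
    assume "q \<in> fps_over K0 \<and> q * (e - 1) = fps_X"
    then have "q * \<psi> = 1"
      by (intro cancel) (simp add: X)
    then show "q = \<phi>0"
      by (metis \<phi>0(2) mult.assoc mult_1_left mult_1_right)
  qed (simp add: X \<phi>0)
  then show "\<exists>!q. q \<in> fps_over K0 \<and> q * (e - 1) = fps_X"
    by simp
  have quot: "quot (fps_over K0) fps_X (e - 1) = \<phi>0"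
    by (simp add: quot_def sol)
  have "\<phi>0 $ 0 * d = 1"
    using \<phi>0(3) \<psi>(2) by (metis fps_mult_nth_0 fps_one_nth)
  then have "\<phi>0 $ 0 = c"
    using d by (metis mult.assoc mult_1_left mult_1_right)
  moreover have "solves_functional_eq K0 \<phi>0"
    using solves_functional_eq_iff_multiplicative [OF \<phi>0(1) \<psi>(1) \<phi>0(3)] e(4)
    by (simp add: e_def d_def flip: e_eq)
  moreover have "\<phi> = \<phi>0" if \<phi>: "\<phi> \<in> fps_over K0" "solves_functional_eq K0 \<phi>" "\<phi> $ 0 = c"
  proof -
    obtain \<psi>' where \<psi>': "\<psi>' \<in> fps_over K0" "\<phi> * \<psi>' = 1" "\<psi>' * \<phi> = 1"
      using fps_over_inverse \<phi> assms(2) by blast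
    \<comment> \<open>Any solution yields a solution of the exponential system for the same
      \<open>c\<close>, and that one is unique.\<close>
    have "1 + fps_X * \<psi>' = e"
      using functional_eq_imp_exp_system [OF \<phi>(1) \<psi>'(1,2) \<phi>(2)] \<phi>(3)
        solves_exp_system_iff [OF assms(1,2)] by (metis e_def)
    then have "\<phi> * (e - 1) = \<phi> * \<psi>' * fps_X"
      by (auto simp: mult.assoc fps_mult_fps_X_commute)
    also have "\<dots> = fps_X"
      by (simp add: \<psi>'(2))
    finally show ?thesis
      using sol \<phi>(1) by blast
  qed
  ultimately show "\<phi> \<in> fps_over K0 \<and> solves_functional_eq K0 \<phi> \<and> \<phi> $ 0 = c \<longleftrightarrow>
      \<phi> = quot (fps_over K0) fps_X (e - 1)"
    unfolding quot using \<phi>0(1) by blast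
qed

end

theorem theorem5p1:
  fixes K0 K1 :: "'a::{ring, monoid_mult} set"
  assumes "comm_superring K0 K1"
  shows
    "(\<forall>\<phi>\<in>fps_over K0. solves_functional_eq K0 \<phi> \<and> \<phi> $ 0 \<in> invertibles K0 \<longrightarrow>
        \<phi> \<in> invertibles (fps_over K0) \<and>
        quot (fps_over K0) (\<phi> + fps_X) \<phi> \<in> fps_over K0 \<and>
        solves_exp_system K0 (\<phi> $ 0) (quot (fps_over K0) (\<phi> + fps_X) \<phi>))
     \<and> (\<forall>c\<in>invertibles K0.
        ((\<exists>f\<in>fps_over K0. solves_exp_system K0 c f) \<longleftrightarrow> contains_rats K0) \<and>
        (contains_rats K0 \<longrightarrow>
          (\<forall>f. f \<in> fps_over K0 \<and> solves_exp_system K0 c f \<longleftrightarrow>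
               f = exp_series K0 (quot K0 1 c))))
     \<and> (contains_rats (UNIV :: 'a set) \<longrightarrow> (\<forall>c\<in>invertibles K0.
        (\<exists>!q. q \<in> fps_over K0 \<and> q * (exp_series K0 (quot K0 1 c) - 1) = fps_X) \<and>
        (\<forall>\<phi>. \<phi> \<in> fps_over K0 \<and> solves_functional_eq K0 \<phi> \<and> \<phi> $ 0 = c \<longleftrightarrow>
             \<phi> = quot (fps_over K0) fps_X (exp_series K0 (quot K0 1 c) - 1))))"
proof -
  interpret comm_superring K0 K1
    by fact
  show ?thesis
  proof (intro conjI ballI impI)
    fix \<phi>
    assume \<phi>: "\<phi> \<in> fps_over K0" and sol: "solves_functional_eq K0 \<phi> \<and> \<phi> $ 0 \<in> invertibles K0"
    obtain \<psi> where \<psi>: "\<psi> \<in> fps_over K0" "\<phi> * \<psi> = 1" "\<psi> * \<phi> = 1"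
      using fps_over_inverse \<phi> sol by blast
    then show "\<phi> \<in> invertibles (fps_over K0)"
      using \<phi> by (auto simp: invertibles_def)
    show "quot (fps_over K0) (\<phi> + fps_X) \<phi> \<in> fps_over K0"
      "solves_exp_system K0 (\<phi> $ 0) (quot (fps_over K0) (\<phi> + fps_X) \<phi>)"
      using functional_eq_imp_exp_system [OF \<phi> \<psi>(1,2)] sol
      by (simp_all add: quot_add_fps_X [OF \<phi> \<psi>(1,2)])
  next
    fix c
    assume c: "c \<in> invertibles K0"
    show "(\<exists>f\<in>fps_over K0. solves_exp_system K0 c f) \<longleftrightarrow> contains_rats K0"
      using solves_exp_system_imp_contains_rats [OF c] solves_exp_system_iff [OF _ c] by blast
    assume "contains_rats K0"
    then show "\<forall>f. f \<in> fps_over K0 \<and> solves_exp_system K0 c f \<longleftrightarrow>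
        f = exp_series K0 (quot K0 1 c)"
      using solves_exp_system_iff c by blast
  next
    fix c
    assume "contains_rats (UNIV :: 'a set)" and c: "c \<in> invertibles K0"
    then have "contains_rats K0"
      by (simp add: contains_rats_even)
    note sol = functional_eq_solution [OF this c]
    show "\<exists>!q. q \<in> fps_over K0 \<and> q * (exp_series K0 (quot K0 1 c) - 1) = fps_X"
      by (rule sol(1))
    show "\<forall>\<phi>. \<phi> \<in> fps_over K0 \<and> solves_functional_eq K0 \<phi> \<and> \<phi> $ 0 = c \<longleftrightarrow>
        \<phi> = quot (fps_over K0) fps_X (exp_series K0 (quot K0 1 c) - 1)"
      using sol(2) by blast
  qed
qed

end
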